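(* Let $K$ be a commutative ring, $\mathcal{R}$ a quasiassociative algebra over $K$, and $\mathcal{M}$ a $K$-module. Then $\delta^2=0$ on 2-skewsymmetric cochains: for every $n\ge3$ and every 2-skewsymmetric $\psi\in C^n=\mathrm{Hom}_K(\mathcal{R}^{\otimes n},\mathcal{M})$ one has $\delta(\delta\psi)=0$.
   Context: A quasiassociative algebra over $K$ is a $K$-module $\mathcal{R}$ with a $K$-bilinear multiplication $*$ satisfying $a*(b*c)-(a*b)*c=b*(a*c)-(b*a)*c$ for all $a,b,c\in\mathcal{R}$; put $[a,b]=a*b-b*a$ (a Lie bracket). Let $C^n=\mathrm{Hom}_K(\mathcal{R}^{\otimes n},\mathcal{M})$ for $n\ge1$. The operator $\delta:C^n\to C^{n+1}$, $n\geq 1$, is defined by $$\delta\psi(a_1,\ldots,a_n,a)=\sum_{i=1}^n(-1)^{i+1}\psi(a_1,\ldots,\widehat{a_i},\ldots,a_n,\,a_i*a)+\sum_{1\le i<j\le n}(-1)^{i+j+1}\psi([a_i,a_j],a_1,\ldots,\widehat{a_i},\ldots,\widehat{a_j},\ldots,a_n,a),$$ where a hat means the argument is omitted and the second sum is absent for $n<2$. For $n\ge3$ and $2\le\kappa<n$, a cochain $\psi\in C^n$ is called $\kappa$-skewsymmetric if it is skewsymmetric in its first $\kappa$ arguments (changes sign when two of them are interchanged); in particular 2-skewsymmetric means skewsymmetric in the first two arguments. *)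

theory Defs
  imports Complex_Main
begin

locale quasiassociative_algebra = module scale
  for scale :: "'k::comm_ring_1 \<Rightarrow> 'r::ab_group_add \<Rightarrow> 'r" +
  fixes mult :: "'r \<Rightarrow> 'r \<Rightarrow> 'r"  (infixl \<open>\<star>\<close> 70)
  assumes linear_left: "\<And>b. module_hom scale scale (\<lambda>a. a \<star> b)"
    and linear_right: "\<And>a. module_hom scale scale (\<lambda>b. a \<star> b)"
    and quasiassociative: "\<And>a b c. a \<star> (b \<star> c) - (a \<star> b) \<star> c = b \<star> (a \<star> c) - (b \<star> a) \<star> c"

definition commutator :: "('r \<Rightarrow> 'r \<Rightarrow> 'r) \<Rightarrow> 'r \<Rightarrow> 'r \<Rightarrow> 'r::ab_group_add" where
  "commutator mult a b = mult a b - mult b a"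

text \<open>A linear map from the \<open>n\<close>-th tensor power of the algebra to the module is the same as an
  \<open>n\<close>-linear map.  The argument tuple \<open>(a\<^sub>1, \<dots>, a\<^sub>n)\<close> is a list of length \<open>n\<close>; a cochain is
  normalised to be 0 on lists of any other length, so that equality of cochains is
  equality of functions.\<close>

definition cochains ::
  "('k::comm_ring_1 \<Rightarrow> 'r::ab_group_add \<Rightarrow> 'r) \<Rightarrow> ('k \<Rightarrow> 'm::ab_group_add \<Rightarrow> 'm) \<Rightarrow> nat \<Rightarrow> ('r list \<Rightarrow> 'm) set"
  where
  "cochains sR sM n =
     {\<psi>. (\<forall>xs ys. length xs + 1 + length ys = n \<longrightarrow>
              module_hom sR sM (\<lambda>x. \<psi> (xs @ [x] @ ys))) \<and>
         (\<forall>xs. length xs \<noteq> n \<longrightarrow> \<psi> xs = 0)}"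

text \<open>The list is \<open>[a\<^sub>1, \<dots>, a\<^sub>n, a]\<close>.  List positions start at 0, so \<open>a\<^sub>i\<close> is \<open>as ! (i - 1)\<close>;
  shifting both indices turns the sign \<open>(-1)\<^sup>i\<^sup>+\<^sup>1\<close> into \<open>(-1)\<^sup>i\<close> and leaves
  \<open>(-1)\<^sup>i\<^sup>+\<^sup>j\<^sup>+\<^sup>1\<close> unchanged.  \<open>nths as (- {i})\<close> is \<open>as\<close> with the entry at position \<open>i\<close> omitted.\<close>

definition coboundary ::
  "('r::ab_group_add \<Rightarrow> 'r \<Rightarrow> 'r) \<Rightarrow> ('k::comm_ring_1 \<Rightarrow> 'm::ab_group_add \<Rightarrow> 'm) \<Rightarrow> nat \<Rightarrow>
   ('r list \<Rightarrow> 'm) \<Rightarrow> 'r list \<Rightarrow> 'm" where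
  "coboundary mult sM n \<psi> xs =
     (if length xs = n + 1 then
        let as = butlast xs; a = last xs in
          (\<Sum>i<n. sM ((-1) ^ i) (\<psi> (nths as (- {i}) @ [mult (as ! i) a])))
        + (\<Sum>j<n. \<Sum>i<j. sM ((-1) ^ (i + j + 1))
              (\<psi> ([commutator mult (as ! i) (as ! j)] @ nths as (- {i, j}) @ [a])))
      else 0)"

text \<open>Only used for \<open>n \<ge> 3\<close> and \<open>2 \<le> \<kappa> < n\<close>, so all positions below \<open>\<kappa>\<close> exist.\<close>

definition skewsymmetric :: "nat \<Rightarrow> nat \<Rightarrow> ('r list \<Rightarrow> 'm::ab_group_add) \<Rightarrow> bool" where
  "skewsymmetric \<kappa> n \<psi> \<longleftrightarrow>
     (\<forall>xs i j. length xs = n \<longrightarrow> i < j \<longrightarrow> j < \<kappa> \<longrightarrow> \<psi> (xs[i := xs ! j, j := xs ! i]) = - \<psi> xs)"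

end

theory Submission
  imports Defs
begin

text \<open>
  The operator \<open>f \<mapsto> f (a \<star> -)\<close> on functions of the last argument is, up to sign, a representation of
  the commutator bracket, so \<open>\<delta>\<close> is a Chevalley--Eilenberg differential up to sign and \<open>\<delta>\<^sup>2\<close> splits as usual.
  Terms with two operations on the last argument cancel by quasiassociativity, mixed terms cancel in
  pairs, double brackets cancel by the Jacobi identity.  Since every bracket is inserted in front, two
  disjoint brackets always occupy the first two positions, so skew-symmetry there is all that is needed.
  Argument lists are indexed by finite sets of positions: deleting an argument then is deleting an element,
  and signs are controlled by how many smaller positions remain.
\<close>

section \<open>Signs of positions and their change under deletion\<close>

text \<open>For \<open>x\<close> in \<open>A\<close> the exponent is the index of \<open>x\<close>
  in the sorted list of \<open>A\<close>, so this is the sign that \<open>coboundary\<close>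
  attaches to that argument.\<close>

definition position_sign :: "nat set \<Rightarrow> nat \<Rightarrow> 'k::comm_ring_1" where
  "position_sign A x = (-1) ^ card {k \<in> A. k < x}"

definition pairs :: "nat set \<Rightarrow> (nat \<times> nat) set" where
  "pairs A = {(x, y). x \<in> A \<and> y \<in> A \<and> x < y}"

abbreviation entries :: "(nat \<Rightarrow> 'r) \<Rightarrow> nat set \<Rightarrow> 'r list" where
  "entries f A \<equiv> map f (sorted_list_of_set A)"

text \<open>The factor by which the sign of \<open>x\<close> changes when \<open>i\<close> is
  deleted: deleting a smaller position lowers the rank of \<open>x\<close> by one, deleting a larger
  one leaves it.\<close>

definition swap_sign :: "nat \<Rightarrow> nat \<Rightarrow> 'k::comm_ring_1" where
  "swap_sign i x = (if i < x then -1 else 1)"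

lemma position_sign_remove:
  assumes "finite A" "i \<in> A" "i \<noteq> x"
  shows "position_sign (A - {i}) x = swap_sign i x * position_sign A x"
proof (cases "i < x")
  case True
  have "{k \<in> A. k < x} = insert i {k \<in> A - {i}. k < x}"
    using assms True by auto
  then have "card {k \<in> A. k < x} = Suc (card {k \<in> A - {i}. k < x})"
    using assms by simp
  with True show ?thesis
    by (simp add: position_sign_def swap_sign_def)
next
  case False
  then have "{k \<in> A - {i}. k < x} = {k \<in> A. k < x}"
    by auto
  with False show ?thesis
    by (simp add: position_sign_def swap_sign_def)
qed

lemma position_sign_remove2:
  assumes "finite A" "i \<in> A" "j \<in> A" "i \<noteq> j" "x \<noteq> i" "x \<noteq> j"
  shows "position_sign (A - {i, j}) x = swap_sign i x * swap_sign j x * position_sign A x"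
proof -
  have "A - {i, j} = A - {j} - {i}" by auto
  with assms show ?thesis by (simp add: position_sign_remove mult_ac)
qed

text \<open>Deleting two positions in the opposite order flips the total sign. The sign bookkeeping
  for the square of the coboundary rests on this antisymmetry.\<close>

lemma swap_sign_commute: "i \<noteq> x \<Longrightarrow> swap_sign x i = - swap_sign i x"
  by (simp add: swap_sign_def)

lemma position_sign_insert_0:
  assumes "finite B" "0 \<notin> B" "x > 0"
  shows "position_sign (insert 0 B) x = - position_sign B x"
proof -
  have "{k \<in> insert 0 B. k < x} = insert 0 {k \<in> B. k < x}"
    using assms by auto
  then have "card {k \<in> insert 0 B. k < x} = Suc (card {k \<in> B. k < x})"
    using assms by simp
  then show ?thesis
    by (simp add: position_sign_def)
qed

lemma position_sign_0 [simp]: "position_sign A 0 = 1"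
  by (simp add: position_sign_def)

section \<open>Regrouping sums over pairs and triples of positions\<close>

lemma finite_pairs [simp]: "finite A \<Longrightarrow> finite (pairs A)"
  by (rule finite_subset[of _ "A \<times> A"]) (auto simp: pairs_def)

lemma sum_pairs:
  assumes "finite A"
  shows "(\<Sum>y\<in>A. \<Sum>x\<in>{x \<in> A. x < y}. g x y) = (\<Sum>(x, y)\<in>pairs A. g x y)"
  using assms
  by (simp add: sum.Sigma)
     (rule sum.reindex_bij_witness[of _ prod.swap prod.swap]; auto simp: pairs_def)

text \<open>Brings together the two orders in which two arguments can act on the last one.\<close>

lemma sum_pairs_offdiag:
  fixes h :: "nat \<Rightarrow> nat \<Rightarrow> 'm::comm_monoid_add"
  assumes "finite A"
  shows "(\<Sum>i\<in>A. \<Sum>k\<in>A - {i}. h i k) = (\<Sum>(i, j)\<in>pairs A. h i j + h j i)"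
proof -
  have "(\<Sum>k\<in>A - {i}. h i k) = (\<Sum>k\<in>{k \<in> A. k < i}. h i k) + (\<Sum>k\<in>{k \<in> A. i < k}. h i k)" for i
    using assms by (subst sum.union_disjoint[symmetric]) (auto intro: sum.cong)
  moreover have "(\<Sum>i\<in>A. \<Sum>k\<in>{k \<in> A. i < k}. h i k) = (\<Sum>(i, j)\<in>pairs A. h i j)"
    using assms by (simp add: sum.Sigma) (rule sum.cong; auto simp: pairs_def)
  ultimately show ?thesis
    using sum_pairs[OF assms, of "\<lambda>x y. h y x"]
    by (simp add: sum.distrib case_prod_unfold add.commute)
qed

text \<open>Both sides run over a pair and a position outside it. This matches an action followed by
  a bracket with a bracket followed by an action.\<close>

lemma sum_pairs_swap:
  assumes "finite A"
  shows "(\<Sum>k\<in>A. \<Sum>(i, j)\<in>pairs (A - {k}). h i j k) = (\<Sum>(i, j)\<in>pairs A. \<Sum>k\<in>A - {i, j}. h i j k)"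
  using assms
  by (simp add: sum.Sigma case_prod_unfold)
     (rule sum.reindex_bij_witness[of _ prod.swap prod.swap]; auto simp: pairs_def)

text \<open>Each increasing triple arises from three choices of a pair and a remaining position, and
  \<open>cyc\<close> sums these three terms. It is the summation form of the Jacobi
  identity.\<close>

lemma sum_pairs_cyclic:
  fixes t :: "nat \<Rightarrow> nat \<Rightarrow> nat \<Rightarrow> 'm::ab_group_add"
  assumes fin: "finite A"
    and cyc: "\<And>i j k. i \<in> A \<Longrightarrow> j \<in> A \<Longrightarrow> k \<in> A \<Longrightarrow> i < j \<Longrightarrow> j < k \<Longrightarrow>
      t i j k + t i k j + t j k i = 0"
  shows "(\<Sum>(i, j)\<in>pairs A. \<Sum>k\<in>A - {i, j}. t i j k) = 0"
proof -
  define T where "T = {(i, j, k). i \<in> A \<and> j \<in> A \<and> k \<in> A \<and> i < j \<and> j < k}"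
  have finT [simp]: "finite T"
    by (rule finite_subset[of _ "A \<times> A \<times> A"]) (use fin in \<open>auto simp: T_def\<close>)
  define S where "S = Sigma (pairs A) (\<lambda>(i, j). A - {i, j})"
  \<comment> \<open>The remaining position is the largest, the middle or the smallest of the triple,
    respectively.\<close>
  have S: "S = (\<lambda>(i, j, k). ((i, j), k)) ` T \<union> (\<lambda>(i, j, k). ((i, k), j)) ` T \<union> (\<lambda>(i, j, k). ((j, k), i)) ` T"
    (is "_ = ?S1 \<union> ?S2 \<union> ?S3")
  proof (intro set_eqI iffI)
    fix z assume "z \<in> S"
    then obtain i j k where z: "z = ((i, j), k)" "i \<in> A" "j \<in> A" "i < j" "k \<in> A" "k \<noteq> i" "k \<noteq> j"
      by (auto simp: S_def pairs_def)
    then consider "j < k" | "i < k" "k < j" | "k < i"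
      by linarith
    then show "z \<in> ?S1 \<union> ?S2 \<union> ?S3"
    proof cases
      case 1
      with z have "z \<in> ?S1" by (intro image_eqI[of _ _ "(i, j, k)"]) (auto simp: T_def)
      then show ?thesis by blast
    next
      case 2
      with z have "z \<in> ?S2" by (intro image_eqI[of _ _ "(i, k, j)"]) (auto simp: T_def)
      then show ?thesis by blast
    next
      case 3
      with z have "z \<in> ?S3" by (intro image_eqI[of _ _ "(k, i, j)"]) (auto simp: T_def)
      then show ?thesis by blast
    qed
  qed (auto simp: S_def T_def pairs_def)
  have "(\<Sum>(i, j)\<in>pairs A. \<Sum>k\<in>A - {i, j}. t i j k) = (\<Sum>((i, j), k)\<in>S. t i j k)"
    using fin by (simp add: S_def sum.Sigma case_prod_unfold)
  also have "\<dots> = (\<Sum>((i, j), k)\<in>?S1. t i j k) + (\<Sum>((i, j), k)\<in>?S2. t i j k) + (\<Sum>((i, j), k)\<in>?S3. t i j k)"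
  proof -
    have "?S1 \<inter> ?S2 = {}" "(?S1 \<union> ?S2) \<inter> ?S3 = {}"
      by (auto simp: T_def)
    then show ?thesis
      unfolding S by (simp add: sum.union_disjoint)
  qed
  also have "\<dots> = (\<Sum>(i, j, k)\<in>T. t i j k + t i k j + t j k i)"
  proof -
    have "inj_on (\<lambda>(i, j, k). ((i, j), k)) T" "inj_on (\<lambda>(i, j, k). ((i, k), j)) T"
      "inj_on (\<lambda>(i, j, k). ((j, k), i)) T"
      by (auto simp: inj_on_def)
    note reindex = this[THEN sum.reindex]
    show ?thesis
      by (simp only: case_prod_unfold reindex[unfolded case_prod_unfold] sum.distrib comp_def fst_conv snd_conv)
  qed
  also have "\<dots> = 0"
    by (rule sum.neutral) (auto simp: T_def cyc)
  finally show ?thesis .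
qed

text \<open>The diagonal needs its own hypothesis: antisymmetry yields only
  \<open>h p p + h p p = 0\<close>, which does not force 0 in a group with 2-torsion.\<close>

lemma sum_alternating:
  fixes h :: "'i \<Rightarrow> 'i \<Rightarrow> 'm::ab_group_add"
  assumes "finite P"
    and diag: "\<And>p. p \<in> P \<Longrightarrow> h p p = 0"
    and anti: "\<And>p q. p \<in> P \<Longrightarrow> q \<in> P \<Longrightarrow> h q p = - h p q"
  shows "(\<Sum>p\<in>P. \<Sum>q\<in>P. h p q) = 0"
proof -
  \<comment> \<open>The hypotheses are tied to \<open>P\<close>, so the induction runs over its
    subsets. A new element adds a zero diagonal entry and a row and a column that cancel.\<close>
  have "(\<Sum>p\<in>Q. \<Sum>q\<in>Q. h p q) = 0" if "finite Q" "Q \<subseteq> P" for Q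
    using that
  proof (induction Q)
    case empty
    show ?case by simp
  next
    case (insert x Q)
    have "(\<Sum>p\<in>Q. h p x) = (\<Sum>q\<in>Q. - h x q)"
      by (rule sum.cong[OF refl], rule anti) (use insert.prems in blast)+
    moreover have "(\<Sum>p\<in>Q. \<Sum>q\<in>Q. h p q) = 0"
      using insert.IH insert.prems by blast
    moreover have "h x x = 0"
      using diag insert.prems by blast
    ultimately show ?case
      using insert.hyps by (simp add: sum.distrib sum_negf)
  qed
  with \<open>finite P\<close> show ?thesis by blast
qed

section \<open>The coboundary in terms of sets of positions\<close>

text \<open>Sorted lists without repetition are determined by their sets, and since indexing is
  injective, omitting the indices \<open>J\<close> removes exactly the entries at
  \<open>J\<close>.\<close>

lemma nths_sorted_list_of_set_remove:
  assumes "finite A" "J \<subseteq> {..<card A}"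
  shows "nths (sorted_list_of_set A) (- J) = sorted_list_of_set (A - (!) (sorted_list_of_set A) ` J)"
proof (rule sorted_distinct_set_unique)
  let ?q = "sorted_list_of_set A"
  show "set (nths ?q (- J)) = set (sorted_list_of_set (A - (!) ?q ` J))"
  proof -
    have "set (nths ?q (- J)) = (!) ?q ` ({..<card A} - J)"
      using assms by (auto simp: set_nths)
    also have "\<dots> = (!) ?q ` {..<card A} - (!) ?q ` J"
    proof (rule inj_on_image_set_diff)
      show "inj_on ((!) ?q) {..<card A}"
        using assms(1) by (intro inj_on_nth) auto
    qed (use assms(2) in auto)
    also have "(!) ?q ` {..<card A} = A"
      using assms(1) nth_image[of "card A" ?q] by (simp add: atLeast0LessThan)
    finally show ?thesis using assms(1) by simp
  qed
qed (use assms(1) in \<open>simp_all add: sorted_nths\<close>)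

text \<open>The sorted list is an increasing bijection from indices to \<open>A\<close>; signs,
  omissions and the condition on index pairs all transport along it.\<close>

lemma coboundary_sorted:
  fixes \<psi> :: "'r::ab_group_add list \<Rightarrow> 'm::ab_group_add"
  assumes fin: "finite A" and card: "card A = n"
  shows "coboundary mult sM n \<psi> (entries f A @ [a]) =
    (\<Sum>x\<in>A. sM (position_sign A x) (\<psi> (entries f (A - {x}) @ [mult (f x) a]))) +
    (\<Sum>(x, y)\<in>pairs A. sM (- (position_sign A x * position_sign A y))
       (\<psi> (commutator mult (f x) (f y) # entries f (A - {x, y}) @ [a])))"
proof -
  define q where "q = sorted_list_of_set A"
  have q: "length q = n" "distinct q" "set q = A" "sorted_wrt (<) q"
    using fin card by (simp_all add: q_def)
  have mono: "q ! i < q ! j \<longleftrightarrow> i < j" if "i < n" "j < n" for i j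
    using that q by (metis linorder_neqE_nat order_less_asym sorted_wrt_nth_less)
  have bij: "bij_betw ((!) q) {..<n} A"
    using q bij_betw_nth by blast
  \<comment> \<open>Counting both sides gives \<open>sign\<close>; the same bijection reindexes the
    inner sum over brackets.\<close>
  have bij': "bij_betw ((!) q) {..<j} {x \<in> A. x < q ! j}" if "j < n" for j
  proof -
    have "(!) q ` {..<j} = {x \<in> A. x < q ! j}"
    proof (intro set_eqI iffI)
      fix x assume "x \<in> {x \<in> A. x < q ! j}"
      then obtain i where "i < n" "x = q ! i" "x < q ! j"
        using q by (metis (mono_tags, lifting) in_set_conv_nth mem_Collect_eq)
      then show "x \<in> (!) q ` {..<j}"
        using mono that by auto
    qed (use that mono q in auto)
    moreover have "inj_on ((!) q) {..<j}"
      using bij that by (auto simp: bij_betw_def elim!: inj_on_subset)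
    ultimately show ?thesis by (simp add: bij_betw_def)
  qed
  have sign: "position_sign A (q ! j) = (-1) ^ j" if "j < n" for j
    using bij_betw_same_card[OF bij'[OF that]] by (simp add: position_sign_def)
  have nths: "nths (map f q) (- J) = entries f (A - (!) q ` J)" if "J \<subseteq> {..<n}" for J
    using nths_sorted_list_of_set_remove[OF fin] that card by (simp add: nths_map q_def)
  have "(\<Sum>i<n. sM ((-1) ^ i) (\<psi> (nths (map f q) (- {i}) @ [mult (map f q ! i) a]))) =
    (\<Sum>i<n. sM (position_sign A (q ! i)) (\<psi> (entries f (A - {q ! i}) @ [mult (f (q ! i)) a])))"
    by (rule sum.cong) (auto simp: sign nths q)
  also have "\<dots> = (\<Sum>x\<in>A. sM (position_sign A x) (\<psi> (entries f (A - {x}) @ [mult (f x) a])))"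
    by (rule sum.reindex_bij_betw[OF bij])
  finally have 1: "(\<Sum>i<n. sM ((-1) ^ i) (\<psi> (nths (map f q) (- {i}) @ [mult (map f q ! i) a]))) = \<dots>" .
  let ?g = "\<lambda>x y. sM (- (position_sign A x * position_sign A y))
       (\<psi> (commutator mult (f x) (f y) # entries f (A - {x, y}) @ [a]))"
  have "(\<Sum>j<n. \<Sum>i<j. sM ((-1) ^ (i + j + 1))
      (\<psi> ([commutator mult (map f q ! i) (map f q ! j)] @ nths (map f q) (- {i, j}) @ [a]))) =
    (\<Sum>j<n. \<Sum>i<j. ?g (q ! i) (q ! j))"
    by (intro sum.cong) (auto simp: sign nths q power_add)
  also have "\<dots> = (\<Sum>j<n. \<Sum>x\<in>{x \<in> A. x < q ! j}. ?g x (q ! j))"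
    by (intro sum.cong refl sum.reindex_bij_betw[OF bij']) auto
  also have "\<dots> = (\<Sum>y\<in>A. \<Sum>x\<in>{x \<in> A. x < y}. ?g x y)"
    by (rule sum.reindex_bij_betw[OF bij])
  also have "\<dots> = (\<Sum>(x, y)\<in>pairs A. ?g x y)"
    by (rule sum_pairs[OF fin])
  finally show ?thesis
    using 1 q by (simp add: coboundary_def Let_def q_def[symmetric])
qed

text \<open>Position 0 is kept free for the bracket that \<open>\<delta>\<close> puts in front.\<close>

lemma entries_insert_0:
  assumes "finite B" "0 \<notin> B"
  shows "entries (f(0 := c)) (insert 0 B) = c # entries f B"
proof -
  have "sorted_list_of_set (insert 0 B) = 0 # sorted_list_of_set B"
    by (rule sorted_distinct_set_unique)
      (use assms in \<open>auto simp del: sorted_list_of_set_insert_remove sorted_list_of_set_insert\<close>)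
  with assms show ?thesis by (simp only: list.map fun_upd_same) simp
qed

lemma pairs_insert_0:
  assumes "0 \<notin> B"
  shows "pairs (insert 0 B) = Pair 0 ` B \<union> pairs B"
  using assms by (auto simp: pairs_def intro!: gr0I)

text \<open>With \<open>c\<close> at position 0, every position of \<open>B\<close> moves up by one
  and contributes an extra minus. Actions of \<open>B\<close> keep this minus. In brackets with
  \<open>c\<close> it cancels the minus that brackets carry. In brackets within \<open>B\<close> the
  two extra signs cancel and the bracket's own minus stays.\<close>

lemma coboundary_Cons_entries:
  fixes \<psi> :: "'r::ab_group_add list \<Rightarrow> 'm::ab_group_add" and sM :: "'k::comm_ring_1 \<Rightarrow> 'm \<Rightarrow> 'm"
  assumes "module sM" and fin: "finite B" and B0: "0 \<notin> B" and card: "Suc (card B) = n"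
  shows "coboundary mult sM n \<psi> (c # entries f B @ [a]) =
    \<psi> (entries f B @ [mult c a]) -
    (\<Sum>k\<in>B. sM (position_sign B k) (\<psi> (c # entries f (B - {k}) @ [mult (f k) a]))) +
    (\<Sum>k\<in>B. sM (position_sign B k) (\<psi> (commutator mult c (f k) # entries f (B - {k}) @ [a]))) -
    (\<Sum>(k, l)\<in>pairs B. sM (position_sign B k * position_sign B l)
       (\<psi> (commutator mult (f k) (f l) # c # entries f (B - {k, l}) @ [a])))"
proof -
  interpret module sM by fact
  let ?f = "f(0 := c)"
  have pos: "k > 0" if "k \<in> B" for k using that B0 by (metis gr0I)
  have ins: "insert 0 B - J = insert 0 (B - J)" if "0 \<notin> J" for J using that by auto
  have ent: "entries ?f (insert 0 (B - J)) = c # entries f (B - J)" for J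
    using fin B0 by (intro entries_insert_0) auto
  have ent': "entries ?f B = entries f B" "entries ?f (B - J) = entries f (B - J)" for J
    using fin B0 by auto
  have sgn: "position_sign (insert 0 B) k = (- position_sign B k :: 'k)" if "k \<in> B" for k
    using position_sign_insert_0[OF fin B0 pos[OF that]] .
  have "coboundary mult sM n \<psi> (c # entries f B @ [a]) =
      coboundary mult sM n \<psi> (entries ?f (insert 0 B) @ [a])"
    using ent[of "{}"] by simp
  also have "\<dots> = (\<Sum>x\<in>insert 0 B. sM (position_sign (insert 0 B) x)
        (\<psi> (entries ?f (insert 0 B - {x}) @ [mult (?f x) a]))) +
      (\<Sum>(x, y)\<in>pairs (insert 0 B). sM (- (position_sign (insert 0 B) x * position_sign (insert 0 B) y))
       (\<psi> (commutator mult (?f x) (?f y) # entries ?f (insert 0 B - {x, y}) @ [a])))"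
    (is "_ = ?X + ?Y") using fin B0 card by (intro coboundary_sorted) auto
  also have "?X = \<psi> (entries f B @ [mult c a]) +
      (\<Sum>x\<in>B. sM (position_sign (insert 0 B) x) (\<psi> (entries ?f (insert 0 B - {x}) @ [mult (?f x) a])))"
    using fin B0 by (subst sum.insert) (simp_all add: ent' flip: fun_upd_def)
  also have "(\<Sum>x\<in>B. sM (position_sign (insert 0 B) x) (\<psi> (entries ?f (insert 0 B - {x}) @ [mult (?f x) a]))) =
      - (\<Sum>k\<in>B. sM (position_sign B k) (\<psi> (c # entries f (B - {k}) @ [mult (f k) a])))"
    unfolding sum_negf[symmetric]
  proof (rule sum.cong)
    fix k assume "k \<in> B"
    with pos[OF this] show "sM (position_sign (insert 0 B) k)
        (\<psi> (entries ?f (insert 0 B - {k}) @ [mult (?f k) a])) =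
      - sM (position_sign B k) (\<psi> (c # entries f (B - {k}) @ [mult (f k) a]))"
      by (subst ins, simp) (simp only: ent sgn, simp)
  qed simp
  also have "?Y = (\<Sum>(x, y)\<in>Pair 0 ` B. sM (- (position_sign (insert 0 B) x * position_sign (insert 0 B) y))
       (\<psi> (commutator mult (?f x) (?f y) # entries ?f (insert 0 B - {x, y}) @ [a]))) +
     (\<Sum>(x, y)\<in>pairs B. sM (- (position_sign (insert 0 B) x * position_sign (insert 0 B) y))
       (\<psi> (commutator mult (?f x) (?f y) # entries ?f (insert 0 B - {x, y}) @ [a])))"
    (is "_ = ?Y1 + ?Y2") unfolding pairs_insert_0[OF B0]
    using fin B0 finite_pairs[OF fin] by (intro sum.union_disjoint) (auto simp: pairs_def)
  also have "?Y1 = (\<Sum>k\<in>B. sM (- position_sign (insert 0 B) k)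
       (\<psi> (commutator mult c (?f k) # entries ?f (insert 0 B - {0, k}) @ [a])))"
    by (subst sum.reindex) (simp_all add: inj_on_def)
  also have "\<dots> = (\<Sum>k\<in>B. sM (position_sign B k) (\<psi> (commutator mult c (f k) # entries f (B - {k}) @ [a])))"
  proof (rule sum.cong)
    fix k assume k: "k \<in> B"
    have "insert 0 B - {0, k} = B - {k}" using B0 by auto
    with pos[OF k] sgn[OF k] show "sM (- position_sign (insert 0 B) k)
        (\<psi> (commutator mult c (?f k) # entries ?f (insert 0 B - {0, k}) @ [a])) =
      sM (position_sign B k) (\<psi> (commutator mult c (f k) # entries f (B - {k}) @ [a]))"
      by (simp only: ent') simp
  qed simp
  also have "?Y2 = - (\<Sum>(k, l)\<in>pairs B. sM (position_sign B k * position_sign B l)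
       (\<psi> (commutator mult (f k) (f l) # c # entries f (B - {k, l}) @ [a])))"
    unfolding sum_negf[symmetric]
  proof (rule sum.cong, simp, clarify)
    fix k l assume "(k, l) \<in> pairs B"
    then have kl: "k \<in> B" "l \<in> B" by (auto simp: pairs_def)
    from pos[OF kl(1)] pos[OF kl(2)] have "insert 0 B - {k, l} = insert 0 (B - {k, l})"
      by (intro ins) auto
    with pos[OF kl(1)] pos[OF kl(2)] kl show "sM (- (position_sign (insert 0 B) k * position_sign (insert 0 B) l))
        (\<psi> (commutator mult (?f k) (?f l) # entries ?f (insert 0 B - {k, l}) @ [a])) =
      - sM (position_sign B k * position_sign B l)
        (\<psi> (commutator mult (f k) (f l) # c # entries f (B - {k, l}) @ [a]))"
      by (simp only: ent sgn) simp
  qed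
  finally show ?thesis by (simp add: algebra_simps)
qed

section \<open>The square of the coboundary on one argument list\<close>

lemma coboundary_coboundary_entries:
  fixes sR :: "'k::comm_ring_1 \<Rightarrow> 'r::ab_group_add \<Rightarrow> 'r"
    and mult :: "'r \<Rightarrow> 'r \<Rightarrow> 'r"  (infixl \<open>\<star>\<close> 70)
    and sM :: "'k \<Rightarrow> 'm::ab_group_add \<Rightarrow> 'm"
  assumes "quasiassociative_algebra sR mult"
    and mod: "module sM"
    and n: "n \<ge> 3"
    and cochain: "\<psi> \<in> cochains sR sM n"
    and skew: "skewsymmetric 2 n \<psi>"
    and fin: "finite A" and A0: "0 \<notin> A" and card: "card A = n + 1"
  shows "coboundary mult sM (n + 1) (coboundary mult sM n \<psi>) (entries f A @ [a]) = 0"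
proof -
  interpret quasiassociative_algebra sR mult by fact
  interpret M: module sM by fact
  let ?s = "position_sign A :: nat \<Rightarrow> 'k"
  let ?e = "swap_sign :: nat \<Rightarrow> nat \<Rightarrow> 'k"
  let ?br = "\<lambda>i j. commutator mult (f i) (f j)"
  \<comment> \<open>Linearity in the last slot serves the quasiassociativity terms, linearity in the
    first slot (\<open>hom_hd\<close>) the Jacobi terms.\<close>
  have hom_last: "module_hom sR sM (\<lambda>x. \<psi> (xs @ [x]))" if "length xs + 1 = n" for xs
    using cochain that by (force simp: cochains_def)
  have hom_hd: "module_hom sR sM (\<lambda>x. \<psi> (x # xs))" if "length xs + 1 = n" for xs
  proof -
    from cochain have "module_hom sR sM (\<lambda>x. \<psi> ([] @ [x] @ xs))"
      unfolding cochains_def using that by (simp del: append_Nil append_Cons)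
    then show ?thesis by simp
  qed
  have swap: "\<psi> (y # x # xs) = - \<psi> (x # y # xs)" if "length xs + 2 = n" for x y xs
    using skew[unfolded skewsymmetric_def, rule_format, of "x # y # xs" 0 1] that by simp
  have diff_l: "(x - y) \<star> z = x \<star> z - y \<star> z" for x y z
    using module_hom.diff[OF linear_left] .
  have diff_r: "z \<star> (x - y) = z \<star> x - z \<star> y" for x y z
    using module_hom.diff[OF linear_right] .
  \<comment> \<open>Quasiassociativity rearranged: left multiplication by a commutator is the
    commutator of the left multiplications.\<close>
  have bracket: "commutator mult x y \<star> z = x \<star> (y \<star> z) - y \<star> (x \<star> z)" for x y z
    using quasiassociative[of x y z] by (simp add: commutator_def diff_l algebra_simps)
  \<comment> \<open>Expanding by \<open>bracket\<close> leaves only right-nested triple products,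
    which cancel termwise. The middle sign is the one that \<open>t4\<close> produces for increasing
    positions.\<close>
  have jacobi: "commutator mult (commutator mult x y) z - commutator mult (commutator mult x z) y
      + commutator mult (commutator mult y z) x = 0" for x y z
  proof -
    have "commutator mult (commutator mult x y) z =
        x \<star> (y \<star> z) - y \<star> (x \<star> z) - z \<star> (x \<star> y) + z \<star> (y \<star> x)" for x y z
      by (subst commutator_def) (simp add: bracket, simp add: commutator_def diff_r)
    then show ?thesis by simp
  qed
  have card1: "card (A - {k}) = n" if "k \<in> A" for k
    using that card fin by simp
  have card2: "card (A - {i, j}) = n - 1" if "i \<in> A" "j \<in> A" "i \<noteq> j" for i j
    using that card fin by (simp add: card_Diff_subset)
  have card3: "card (A - {i, j, k}) = n - 2"
    if "i \<in> A" "j \<in> A" "k \<in> A" "i \<noteq> j" "i \<noteq> k" "j \<noteq> k" for i j k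
    using that card fin by (simp add: card_Diff_subset)
  have card4: "card (A - {i, j, k, l}) = n - 3"
    if "i \<in> A" "j \<in> A" "k \<in> A" "l \<in> A" "i \<noteq> j" "k \<notin> {i, j}" "l \<notin> {i, j}" "k \<noteq> l" for i j k l
    using that card fin by (simp add: card_Diff_subset)

  \<comment> \<open>The two successive operations are: two actions on the last argument
    (\<open>t1\<close>), a bracket and an action of a third argument (\<open>t2\<close>), a bracket
    that itself acts (\<open>t3\<close>), a bracket inside a bracket (\<open>t4\<close>), two
    disjoint brackets (\<open>t5\<close>). All signs are reduced to those of
    \<open>A\<close>.\<close>
  define t1 where "t1 k i = sM (?s k * (?e k i * ?s i)) (\<psi> (entries f (A - {k, i}) @ [f i \<star> (f k \<star> a)]))" for k i
  define t2 where "t2 i j k = sM (?s i * ?s j * (?e i k * ?e j k * ?s k))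
    (\<psi> (?br i j # entries f (A - {i, j, k}) @ [f k \<star> a]))" for i j k
  define t3 where "t3 i j = sM (?s i * ?s j) (\<psi> (entries f (A - {i, j}) @ [?br i j \<star> a]))" for i j
  define t4 where "t4 i j k = sM (?s i * ?s j * (?e i k * ?e j k * ?s k))
    (\<psi> (commutator mult (?br i j) (f k) # entries f (A - {i, j, k}) @ [a]))" for i j k
  define t5 where "t5 i j k l = sM (?s i * ?s j * ((?e i k * ?e j k * ?s k) * (?e i l * ?e j l * ?s l)))
    (\<psi> (?br k l # ?br i j # entries f (A - {i, j, k, l}) @ [a]))" for i j k l

  \<comment> \<open>Moving the deletion of \<open>k\<close> past \<open>i\<close> and
    \<open>j\<close> costs two signs, which cancel, so \<open>t2\<close> keeps the minus of the
    bracket. In \<open>outer2\<close> it gets a plus, as the bracket in front shifts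
    \<open>k\<close> by one.\<close>
  have outer1: "sM (?s k) (coboundary mult sM n \<psi> (entries f (A - {k}) @ [f k \<star> a])) =
      (\<Sum>i\<in>A - {k}. t1 k i) + (\<Sum>(i, j)\<in>pairs (A - {k}). - t2 i j k)" if k: "k \<in> A" for k
  proof -
    let ?B = "A - {k}"
    have "coboundary mult sM n \<psi> (entries f ?B @ [f k \<star> a]) =
      (\<Sum>i\<in>?B. sM (position_sign ?B i) (\<psi> (entries f (?B - {i}) @ [f i \<star> (f k \<star> a)]))) +
      (\<Sum>(i, j)\<in>pairs ?B. sM (- (position_sign ?B i * position_sign ?B j))
       (\<psi> (?br i j # entries f (?B - {i, j}) @ [f k \<star> a])))"
      using fin card1[OF k] by (intro coboundary_sorted) auto
    moreover have "sM (?s k) (\<Sum>i\<in>?B. sM (position_sign ?B i) (\<psi> (entries f (?B - {i}) @ [f i \<star> (f k \<star> a)])))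
        = (\<Sum>i\<in>?B. t1 k i)"
      unfolding M.scale_sum_right
    proof (rule sum.cong)
      fix i assume i: "i \<in> ?B"
      have "?B - {i} = A - {k, i}" by auto
      with i k fin show "sM (?s k) (sM (position_sign ?B i)
          (\<psi> (entries f (?B - {i}) @ [f i \<star> (f k \<star> a)]))) = t1 k i"
        by (simp add: t1_def position_sign_remove)
    qed simp
    moreover have "sM (?s k) (\<Sum>(i, j)\<in>pairs ?B. sM (- (position_sign ?B i * position_sign ?B j))
       (\<psi> (?br i j # entries f (?B - {i, j}) @ [f k \<star> a]))) = (\<Sum>(i, j)\<in>pairs ?B. - t2 i j k)"
      unfolding M.scale_sum_right
    proof (rule sum.cong, simp, clarify)
      fix i j assume "(i, j) \<in> pairs ?B"
      then have ij: "i \<in> A" "j \<in> A" "i \<noteq> k" "j \<noteq> k" by (auto simp: pairs_def)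
      have "?B - {i, j} = A - {i, j, k}" by auto
      with ij k fin show "sM (?s k) (sM (- (position_sign ?B i * position_sign ?B j))
          (\<psi> (?br i j # entries f (?B - {i, j}) @ [f k \<star> a]))) = - t2 i j k"
        by (simp add: t2_def position_sign_remove swap_sign_commute[of i k] swap_sign_commute[of j k] mult_ac)
    qed
    ultimately show ?thesis
      by (simp only: M.scale_right_distrib)
  qed

  have outer2: "sM (- (?s i * ?s j)) (coboundary mult sM n \<psi> (?br i j # entries f (A - {i, j}) @ [a])) =
      - t3 i j + (\<Sum>k\<in>A - {i, j}. t2 i j k) - (\<Sum>k\<in>A - {i, j}. t4 i j k)
      + (\<Sum>(k, l)\<in>pairs (A - {i, j}). t5 i j k l)" if ij: "(i, j) \<in> pairs A" for i j
  proof -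
    let ?B = "A - {i, j}"
    have ij': "i \<in> A" "j \<in> A" "i \<noteq> j" using ij by (auto simp: pairs_def)
    have B: "?B - {k} = A - {i, j, k}" "?B - {k, l} = A - {i, j, k, l}" for k l by auto
    have sgn: "position_sign ?B k = ?e i k * ?e j k * ?s k" if "k \<in> ?B" for k
      using that ij' fin by (intro position_sign_remove2) auto
    have "coboundary mult sM n \<psi> (?br i j # entries f ?B @ [a]) =
      \<psi> (entries f ?B @ [?br i j \<star> a]) -
      (\<Sum>k\<in>?B. sM (position_sign ?B k) (\<psi> (?br i j # entries f (?B - {k}) @ [f k \<star> a]))) +
      (\<Sum>k\<in>?B. sM (position_sign ?B k) (\<psi> (commutator mult (?br i j) (f k) # entries f (?B - {k}) @ [a]))) -
      (\<Sum>(k, l)\<in>pairs ?B. sM (position_sign ?B k * position_sign ?B l)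
       (\<psi> (?br k l # ?br i j # entries f (?B - {k, l}) @ [a])))"
      using fin A0 card2[OF ij'] n by (intro coboundary_Cons_entries mod) auto
    moreover have "sM (?s i * ?s j) (\<Sum>k\<in>?B. sM (position_sign ?B k) (\<psi> (?br i j # entries f (?B - {k}) @ [f k \<star> a])))
        = (\<Sum>k\<in>?B. t2 i j k)"
      unfolding M.scale_sum_right by (rule sum.cong) (simp_all only: sgn B t2_def M.scale_scale)
    moreover have "sM (?s i * ?s j) (\<Sum>k\<in>?B. sM (position_sign ?B k) (\<psi> (commutator mult (?br i j) (f k) # entries f (?B - {k}) @ [a])))
        = (\<Sum>k\<in>?B. t4 i j k)"
      unfolding M.scale_sum_right by (rule sum.cong) (simp_all only: sgn B t4_def M.scale_scale)
    moreover have "sM (?s i * ?s j) (\<Sum>(k, l)\<in>pairs ?B. sM (position_sign ?B k * position_sign ?B l)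
       (\<psi> (?br k l # ?br i j # entries f (?B - {k, l}) @ [a])))
        = (\<Sum>(k, l)\<in>pairs ?B. t5 i j k l)"
      unfolding M.scale_sum_right
    proof (rule sum.cong, simp, clarify)
      fix k l assume "(k, l) \<in> pairs ?B"
      then have "k \<in> ?B" "l \<in> ?B" by (auto simp: pairs_def)
      then show "sM (?s i * ?s j) (sM (position_sign ?B k * position_sign ?B l)
          (\<psi> (?br k l # ?br i j # entries f (?B - {k, l}) @ [a]))) = t5 i j k l"
        by (simp only: sgn B t5_def M.scale_scale)
    qed
    ultimately show ?thesis
      by (simp only: t3_def M.scale_minus_left M.scale_right_distrib M.scale_right_diff_distrib)
        (simp add: algebra_simps)
  qed

  have "(\<Sum>k\<in>A. \<Sum>i\<in>A - {k}. t1 k i) = (\<Sum>(i, j)\<in>pairs A. t1 i j + t1 j i)"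
    by (rule sum_pairs_offdiag[OF fin])
  \<comment> \<open>For \<open>i < j\<close> the two orders carry opposite swap signs, so their sum
    is a difference in the last slot, to which \<open>bracket\<close> applies.\<close>
  also have "\<dots> = (\<Sum>(i, j)\<in>pairs A. t3 i j)"
  proof (rule sum.cong, simp, clarify)
    fix i j assume "(i, j) \<in> pairs A"
    then have ij: "i \<in> A" "j \<in> A" "i < j" by (auto simp: pairs_def)
    have "length (entries f (A - {i, j})) + 1 = n" using card2[of i j] ij n by simp
    from module_hom.diff[OF hom_last[OF this]] show "t1 i j + t1 j i = t3 i j"
      using ij by (simp add: t1_def t3_def bracket swap_sign_def insert_commute
          M.scale_right_diff_distrib mult.commute)
  qed
  finally have T1: "(\<Sum>k\<in>A. \<Sum>i\<in>A - {k}. t1 k i) = (\<Sum>(i, j)\<in>pairs A. t3 i j)" .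
  have T2: "(\<Sum>k\<in>A. \<Sum>(i, j)\<in>pairs (A - {k}). t2 i j k) = (\<Sum>(i, j)\<in>pairs A. \<Sum>k\<in>A - {i, j}. t2 i j k)"
    by (rule sum_pairs_swap[OF fin])
  have T4: "(\<Sum>(i, j)\<in>pairs A. \<Sum>k\<in>A - {i, j}. t4 i j k) = 0"
  proof (rule sum_pairs_cyclic[OF fin])
    fix i j k assume ijk: "i \<in> A" "j \<in> A" "k \<in> A" "i < j" "j < k"
    define r where "r = entries f (A - {i, j, k}) @ [a]"
    have "length r + 1 = n" using card3[of i j k] ijk n by (simp add: r_def)
    then interpret H: module_hom sR sM "\<lambda>x. \<psi> (x # r)" by (rule hom_hd)
    \<comment> \<open>For \<open>i < j < k\<close> the swap signs multiply to 1, -1 and 1 in the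
      three terms.\<close>
    have "t4 i j k + t4 i k j + t4 j k i = sM (?s i * ?s j * ?s k)
      (\<psi> (commutator mult (?br i j) (f k) # r) - \<psi> (commutator mult (?br i k) (f j) # r)
        + \<psi> (commutator mult (?br j k) (f i) # r))"
      using ijk by (simp add: t4_def r_def swap_sign_def insert_commute M.scale_right_distrib
          M.scale_right_diff_distrib mult_ac)
    also have "\<dots> = 0"
      using jacobi[of "f i" "f j" "f k"] by (simp flip: H.add H.diff add: H.zero)
    finally show "t4 i j k + t4 i k j + t4 j k i = 0" .
  qed
  have T5: "(\<Sum>(i, j)\<in>pairs A. \<Sum>(k, l)\<in>pairs (A - {i, j}). t5 i j k l) = 0"
  proof -
    \<comment> \<open>Extending \<open>t5\<close> by 0 to overlapping pairs lets both pairs range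
      over all of \<open>pairs A\<close>; the diagonal then vanishes by definition.\<close>
    define h where "h p q = (case p of (i, j) \<Rightarrow> case q of (k, l) \<Rightarrow>
      if k \<in> {i, j} \<or> l \<in> {i, j} then 0 else t5 i j k l)" for p q
    have "(\<Sum>(k, l)\<in>pairs (A - {i, j}). t5 i j k l) = (\<Sum>q\<in>pairs A. h (i, j) q)" for i j
      using finite_pairs[OF fin] by (intro sum.mono_neutral_cong_left) (auto simp: pairs_def h_def)
    then have "(\<Sum>(i, j)\<in>pairs A. \<Sum>(k, l)\<in>pairs (A - {i, j}). t5 i j k l) =
        (\<Sum>p\<in>pairs A. \<Sum>q\<in>pairs A. h p q)"
      by (simp add: case_prod_unfold)
    also have "\<dots> = 0"
    proof (rule sum_alternating)
      show "h q p = - h p q" if p: "p \<in> pairs A" and q: "q \<in> pairs A" for p q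
      proof -
        obtain i j k l where pq: "p = (i, j)" "q = (k, l)" by fastforce
        show ?thesis
        proof (cases "k \<in> {i, j} \<or> l \<in> {i, j}")
          case True
          then show ?thesis by (auto simp: h_def pq)
        next
          case False
          then have ne: "i \<noteq> k" "i \<noteq> l" "j \<noteq> k" "j \<noteq> l" by auto
          \<comment> \<open>Since \<open>n \<ge> 3\<close>, the truncated \<open>n - 3\<close> of
            \<open>card4\<close> is a true difference and the lengths add up to
            \<open>n\<close>.\<close>
          have "length (entries f (A - {i, j, k, l}) @ [a]) + 2 = n"
            using card4[of i j k l] p q ne n by (auto simp: pq pairs_def)
          note swap[OF this, of "?br i j" "?br k l"]
          moreover have "A - {k, l, i, j} = A - {i, j, k, l}" by auto
          \<comment> \<open>Exchanging the pairs reverses four swap signs, so the coefficient is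
            unchanged and the minus comes from \<open>swap\<close> alone.\<close>
          moreover have "?s k * ?s l * ((?e k i * ?e l i * ?s i) * (?e k j * ?e l j * ?s j)) =
              ?s i * ?s j * ((?e i k * ?e j k * ?s k) * (?e i l * ?e j l * ?s l))"
            using ne by (simp add: swap_sign_commute[of i k] swap_sign_commute[of i l]
                swap_sign_commute[of j k] swap_sign_commute[of j l] mult_ac)
          ultimately have "t5 k l i j = - t5 i j k l"
            by (simp only: t5_def M.scale_minus_right)
          with ne show ?thesis by (simp add: h_def pq)
        qed
      qed
    qed (use finite_pairs[OF fin] in \<open>auto simp: h_def\<close>)
    finally show ?thesis .
  qed

  have "coboundary mult sM (n + 1) (coboundary mult sM n \<psi>) (entries f A @ [a]) =
     (\<Sum>k\<in>A. sM (?s k) (coboundary mult sM n \<psi> (entries f (A - {k}) @ [f k \<star> a]))) +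
     (\<Sum>(i, j)\<in>pairs A. sM (- (?s i * ?s j)) (coboundary mult sM n \<psi> (?br i j # entries f (A - {i, j}) @ [a])))"
    by (rule coboundary_sorted[OF fin card])
  also have "\<dots> = (\<Sum>k\<in>A. (\<Sum>i\<in>A - {k}. t1 k i) + (\<Sum>(i, j)\<in>pairs (A - {k}). - t2 i j k)) +
     (\<Sum>(i, j)\<in>pairs A. - t3 i j + (\<Sum>k\<in>A - {i, j}. t2 i j k) - (\<Sum>k\<in>A - {i, j}. t4 i j k)
      + (\<Sum>(k, l)\<in>pairs (A - {i, j}). t5 i j k l))"
    using outer1 outer2 by (intro arg_cong2[of _ _ _ _ "(+)"] sum.cong) auto
  also have "\<dots> = 0"
    using T1 T2 T4 T5 by (simp add: sum.distrib sum_subtractf sum_negf case_prod_unfold)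
  finally show ?thesis .
qed

theorem proposition4p9:
  fixes sR :: "'k::comm_ring_1 \<Rightarrow> 'r::ab_group_add \<Rightarrow> 'r"
    and mult :: "'r \<Rightarrow> 'r \<Rightarrow> 'r"
    and sM :: "'k \<Rightarrow> 'm::ab_group_add \<Rightarrow> 'm"
    and n :: nat
    and \<psi> :: "'r list \<Rightarrow> 'm"
  assumes "quasiassociative_algebra sR mult"
    and "module sM"
    and "n \<ge> 3"
    and "\<psi> \<in> cochains sR sM n"
    and "skewsymmetric 2 n \<psi>"
  shows "coboundary mult sM (n + 1) (coboundary mult sM n \<psi>) = (\<lambda>_. 0)"
proof
  fix xs :: "'r list"
  show "coboundary mult sM (n + 1) (coboundary mult sM n \<psi>) xs = 0"
  proof (cases "length xs = n + 2")
    case True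
    \<comment> \<open>Positions are counted from 1, which leaves 0 free for the bracket.\<close>
    define f where "f i = xs ! (i - 1)" for i
    have "xs = entries f {1..n + 1} @ [last xs]"
    proof -
      have "entries f {1..n + 1} = butlast xs"
        using True
        by (intro nth_equalityI)
           (auto simp: f_def nth_butlast simp del: upt_Suc simp flip: atLeastLessThanSuc_atLeastAtMost)
      moreover have "xs \<noteq> []"
        using True by auto
      ultimately show ?thesis
        by simp
    qed
    moreover have "coboundary mult sM (n + 1) (coboundary mult sM n \<psi>) (entries f {1..n + 1} @ [last xs]) = 0"
      using assms by (intro coboundary_coboundary_entries) auto
    ultimately show ?thesis by simp
  next
    case False
    then show ?thesis by (simp add: coboundary_def)
  qed
qed

end
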